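(* Let $m\ge2$, $d\ge1$ be integers. The determinant ${\rm Det}(U):=\det(\gamma(U))\in\mathbb{C}$, $U\in C\ell^{\frac1m}_d$, where $\gamma$ is a faithful matrix representation of $C\ell^{\frac1m}_d$ of minimal dimension (in the sense of the context), is well defined, i.e. it does not depend on the choice of $\gamma$: for any two such representations $\gamma,\gamma'$ and every $U\in C\ell^{\frac1m}_d$ one has $\det(\gamma(U))=\det(\gamma'(U))$.
   Context: The generalized Clifford algebra $C\ell^{\frac1m}_d$ is the unital associative algebra over $\mathbb{C}$ with identity $e$ and generators $e_1,\dots,e_d$ subject to $e_j^m=e$ for $j=1,\dots,d$ and $e_ke_l=\omega e_le_k$ for $k<l$, where $\omega:=e^{2\pi i/m}$; it has dimension $m^d$. A faithful matrix representation of minimal dimension is an isomorphism $\gamma$ of unital complex algebras from $C\ell^{\frac1m}_d$ onto ${\rm Mat}(m^{\frac d2},\mathbb{C})$ if $d$ is even, and onto the direct sum of $m$ copies of ${\rm Mat}(m^{\frac{d-1}2},\mathbb{C})$, regarded as block-diagonal matrices of size $m^{\frac{d+1}{2}}$, if $d$ is odd. *)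

theory Defs
  imports
    Complex_Main
    "HOL-Algebra.QuotRing"
    "HOL-Algebra.Module"
    "Jordan_Normal_Form.Determinant"
begin

(* The free unital complex algebra on letters 1, ..., d: finitely supported complex
   functions on words, multiplied by convolution over the factorizations of a word. *)

definition free_algebra :: "nat \<Rightarrow> (complex, nat list \<Rightarrow> complex) module" where
  "free_algebra d =
    \<lparr>carrier = {f. finite {w. f w \<noteq> 0} \<and> {w. f w \<noteq> 0} \<subseteq> lists {1..d}},
     monoid.mult = (\<lambda>f g w. \<Sum>(u, v)\<in>{(u, v). u @ v = w}. f u * g v),
     one = (\<lambda>w. if w = [] then 1 else 0),
     zero = (\<lambda>w. 0),
     add = (\<lambda>f g w. f w + g w),
     module.smult = (\<lambda>c f w. c * f w)\<rparr>"

lemma finite_factorizations: "finite {(u, v). u @ v = (w :: 'a list)}"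
proof (rule finite_subset)
  show "{(u, v). u @ v = w} \<subseteq> (\<lambda>i. (take i w, drop i w)) ` {..length w}"
  proof
    fix p assume "p \<in> {(u, v). u @ v = w}"
    then show "p \<in> (\<lambda>i. (take i w, drop i w)) ` {..length w}"
      by (intro image_eqI[of _ _ "length (fst p)"]) auto
  qed
qed simp

lemma sum_factorizations_unit_left:
  fixes f :: "'a list \<Rightarrow> complex"
  shows "(\<Sum>(u, v)\<in>{(u, v). u @ v = w}. (if u = [] then 1 else 0) * f v) = f w"
proof -
  have "(\<Sum>(u, v)\<in>{(u, v). u @ v = w}. (if u = [] then 1 else 0) * f v)
      = (\<Sum>p\<in>{([] :: 'a list, w)}. case p of (u, v) \<Rightarrow> (if u = [] then 1 else 0) * f v)"
    by (rule sum.mono_neutral_right) (auto simp: finite_factorizations split: if_splits)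
  then show ?thesis by simp
qed

lemma sum_factorizations_unit_right:
  fixes f :: "'a list \<Rightarrow> complex"
  shows "(\<Sum>(u, v)\<in>{(u, v). u @ v = w}. f u * (if v = [] then 1 else 0)) = f w"
proof -
  have "(\<Sum>(u, v)\<in>{(u, v). u @ v = w}. f u * (if v = [] then 1 else 0))
      = (\<Sum>p\<in>{(w, [] :: 'a list)}. case p of (u, v) \<Rightarrow> f u * (if v = [] then 1 else 0))"
    by (rule sum.mono_neutral_right) (auto simp: finite_factorizations split: if_splits)
  then show ?thesis by simp
qed

lemma sum_factorizations_assoc:
  fixes f g h :: "'a list \<Rightarrow> complex"
  shows "(\<Sum>(p, c)\<in>{(p, c). p @ c = w}. (\<Sum>(a, b)\<in>{(a, b). a @ b = p}. f a * g b) * h c)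
       = (\<Sum>(a, q)\<in>{(a, q). a @ q = w}. f a * (\<Sum>(b, c)\<in>{(b, c). b @ c = q}. g b * h c))"
proof -
  have "(\<Sum>(p, c)\<in>{(p, c). p @ c = w}. (\<Sum>(a, b)\<in>{(a, b). a @ b = p}. f a * g b) * h c)
      = (\<Sum>x\<in>{(p, c). p @ c = w}. \<Sum>y\<in>{(a, b). a @ b = fst x}.
          f (fst y) * g (snd y) * h (snd x))"
    by (simp add: sum_distrib_right case_prod_beta)
  also have "\<dots> = (\<Sum>(x, y)\<in>(SIGMA x:{(p, c). p @ c = w}. {(a, b). a @ b = fst x}).
      f (fst y) * g (snd y) * h (snd x))"
    by (rule sum.Sigma) (auto simp: finite_factorizations)
  also have "\<dots> = (\<Sum>(x, y)\<in>(SIGMA x:{(a, q). a @ q = w}. {(b, c). b @ c = snd x}).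
      f (fst x) * (g (fst y) * h (snd y)))"
    by (rule sum.reindex_bij_witness[where
          i = "\<lambda>((a, q), (b, c)). ((a @ b, c), (a, b))" and
          j = "\<lambda>((p, c), (a, b)). ((a, b @ c), (b, c))"]) auto
  also have "\<dots> = (\<Sum>x\<in>{(a, q). a @ q = w}. \<Sum>y\<in>{(b, c). b @ c = snd x}.
      f (fst x) * (g (fst y) * h (snd y)))"
    by (rule sum.Sigma[symmetric]) (auto simp: finite_factorizations)
  also have "\<dots> = (\<Sum>(a, q)\<in>{(a, q). a @ q = w}. f a * (\<Sum>(b, c)\<in>{(b, c). b @ c = q}. g b * h c))"
    by (simp add: sum_distrib_left case_prod_beta)
  finally show ?thesis .
qed

lemma free_algebra_mult_closed:
  assumes "f \<in> carrier (free_algebra d)" "g \<in> carrier (free_algebra d)"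
  shows "f \<otimes>\<^bsub>free_algebra d\<^esub> g \<in> carrier (free_algebra d)"
proof -
  let ?S = "(\<lambda>(u, v). u @ v) ` ({w. f w \<noteq> 0} \<times> {w. g w \<noteq> 0})"
  have sub: "{w. (\<Sum>(u, v)\<in>{(u, v). u @ v = w}. f u * g v) \<noteq> 0} \<subseteq> ?S"
  proof
    fix w assume "w \<in> {w. (\<Sum>(u, v)\<in>{(u, v). u @ v = w}. f u * g v) \<noteq> 0}"
    then obtain p where "p \<in> {(u, v). u @ v = w}" "(case p of (u, v) \<Rightarrow> f u * g v) \<noteq> 0"
      by (auto elim: sum.not_neutral_contains_not_neutral)
    then show "w \<in> ?S" by force
  qed
  have "finite ?S" using assms by (auto simp: free_algebra_def)
  moreover have "?S \<subseteq> lists {1..d}"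
    using assms by (fastforce simp: free_algebra_def)
  ultimately show ?thesis
    using finite_subset[OF sub] sub by (auto simp: free_algebra_def)
qed

(* genideal R S intersects sets satisfying a predicate that itself requires R to be a
   ring, so the ideal of relations below is meaningful because of this lemma. *)

lemma free_algebra_ring: "ring (free_algebra d)"
proof (rule ringI)
  show "abelian_group (free_algebra d)"
  proof (rule abelian_groupI)
    fix f g assume fg: "f \<in> carrier (free_algebra d)" "g \<in> carrier (free_algebra d)"
    have "{w. f w + g w \<noteq> 0} \<subseteq> {w. f w \<noteq> 0} \<union> {w. g w \<noteq> 0}" by auto
    from this finite_subset[OF this] fg
    show "f \<oplus>\<^bsub>free_algebra d\<^esub> g \<in> carrier (free_algebra d)"
      by (auto simp: free_algebra_def)
  next
    fix f assume "f \<in> carrier (free_algebra d)"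
    then show "\<exists>g\<in>carrier (free_algebra d). g \<oplus>\<^bsub>free_algebra d\<^esub> f = \<zero>\<^bsub>free_algebra d\<^esub>"
      by (intro bexI[of _ "\<lambda>w. - f w"]) (auto simp: free_algebra_def)
  qed (auto simp: free_algebra_def add_ac)
  show "monoid (free_algebra d)"
  proof (rule monoidI)
    show "\<one>\<^bsub>free_algebra d\<^esub> \<in> carrier (free_algebra d)"
      by (auto simp: free_algebra_def)
  qed (auto simp: free_algebra_mult_closed,
      auto simp: free_algebra_def sum_factorizations_unit_left
        sum_factorizations_unit_right sum_factorizations_assoc)
qed (auto simp: free_algebra_def case_prod_beta distrib_left distrib_right sum.distrib)

definition letter :: "nat \<Rightarrow> nat list \<Rightarrow> complex" where
  "letter j = (\<lambda>w. if w = [j] then 1 else 0)"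

definition root_of_unity :: "nat \<Rightarrow> complex" where
  "root_of_unity m = exp (2 * of_real pi * \<i> / of_nat m)"

definition clifford_relators :: "nat \<Rightarrow> nat \<Rightarrow> (nat list \<Rightarrow> complex) set" where
  "clifford_relators m d =
    (let F = free_algebra d in
      {letter j [^]\<^bsub>F\<^esub> m \<ominus>\<^bsub>F\<^esub> \<one>\<^bsub>F\<^esub> | j. 1 \<le> j \<and> j \<le> d} \<union>
      {letter k \<otimes>\<^bsub>F\<^esub> letter l \<ominus>\<^bsub>F\<^esub> root_of_unity m \<odot>\<^bsub>F\<^esub> (letter l \<otimes>\<^bsub>F\<^esub> letter k)
        | k l. 1 \<le> k \<and> k < l \<and> l \<le> d})"

(* FactRing forgets the scalar action, so it is put back here; its union over
   representatives follows rcoset_mult. *)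

definition quotient_algebra ::
    "(complex, 'a) module \<Rightarrow> 'a set \<Rightarrow> (complex, 'a set) module" where
  "quotient_algebra A I =
    ring.extend (A Quot I)
      (module.fields (\<lambda>c X. \<Union>x\<in>X. I +>\<^bsub>A\<^esub> (c \<odot>\<^bsub>A\<^esub> x)))"

(* Ideals in HOL-Algebra, hence Idl, are two-sided. *)

definition gen_clifford ::
    "nat \<Rightarrow> nat \<Rightarrow> (complex, (nat list \<Rightarrow> complex) set) module" where
  "gen_clifford m d =
    quotient_algebra (free_algebra d) (Idl\<^bsub>free_algebra d\<^esub> (clifford_relators m d))"

(* The direct sum of k copies of Mat(n, C), as block-diagonal matrices of size k * n. *)

definition block_algebra :: "nat \<Rightarrow> nat \<Rightarrow> (complex, complex mat) module" where
  "block_algebra k n =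
    (module_mat TYPE(complex) (k * n) (k * n))
      \<lparr>carrier := {diag_block_mat Bs | Bs. length Bs = k \<and> set Bs \<subseteq> carrier_mat n n}\<rparr>"

definition target_algebra :: "nat \<Rightarrow> nat \<Rightarrow> (complex, complex mat) module" where
  "target_algebra m d =
    (if even d
     then module_mat TYPE(complex) (m ^ (d div 2)) (m ^ (d div 2))
     else block_algebra m (m ^ ((d - 1) div 2)))"

definition algebra_iso :: "(complex, 'a) module \<Rightarrow> (complex, 'b) module \<Rightarrow> ('a \<Rightarrow> 'b) set" where
  "algebra_iso A B =
    {\<gamma> \<in> ring_iso A B. \<forall>c. \<forall>x\<in>carrier A. \<gamma> (c \<odot>\<^bsub>A\<^esub> x) = c \<odot>\<^bsub>B\<^esub> \<gamma> x}"

definition faithful_minimal_rep ::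
    "nat \<Rightarrow> nat \<Rightarrow> ((nat list \<Rightarrow> complex) set \<Rightarrow> complex mat) \<Rightarrow> bool" where
  "faithful_minimal_rep m d \<gamma> \<longleftrightarrow> \<gamma> \<in> algebra_iso (gen_clifford m d) (target_algebra m d)"

end

(* Write phi for the composition of the second representation with the inverse of the first.
   It maps the matrix units E_ii to nonzero idempotents, whose traces are positive integers;
   these add up to the size N of the matrices, so each is 1. The off-diagonal units of a block
   are commutators. By linearity, phi preserves traces. The two images of U therefore have
   equal traces of all powers, hence the same eigenvalues with multiplicities, hence the same
   determinant. *)

theory Submission
  imports Defs "Jordan_Normal_Form.Schur_Decomposition"
begin

section \<open>Traces of matrices and their invariance under similarity\<close>

definition mat_trace :: "'a :: comm_monoid_add mat \<Rightarrow> 'a" where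
  "mat_trace A = (\<Sum>i<dim_row A. A $$ (i, i))"

lemma mat_trace_add:
  assumes "A \<in> carrier_mat n n" "B \<in> carrier_mat n n"
  shows "mat_trace (A + B) = mat_trace A + mat_trace B"
  using assms by (auto simp: mat_trace_def sum.distrib)

lemma mat_trace_smult:
  fixes c :: "'a :: semiring_0"
  assumes "A \<in> carrier_mat n n"
  shows "mat_trace (c \<cdot>\<^sub>m A) = c * mat_trace A"
  using assms by (auto simp: mat_trace_def sum_distrib_left)

lemma mat_trace_mult_commute:
  fixes A B :: "'a :: comm_semiring_0 mat"
  assumes "A \<in> carrier_mat n m" "B \<in> carrier_mat m n"
  shows "mat_trace (A * B) = mat_trace (B * A)"
proof -
  have "mat_trace (A * B) = (\<Sum>i<n. \<Sum>j<m. A $$ (i, j) * B $$ (j, i))"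
    using assms by (auto simp: mat_trace_def scalar_prod_def atLeast0LessThan)
  also have "\<dots> = (\<Sum>j<m. \<Sum>i<n. B $$ (j, i) * A $$ (i, j))"
    by (subst sum.swap) (simp add: mult.commute)
  also have "\<dots> = mat_trace (B * A)"
    using assms by (auto simp: mat_trace_def scalar_prod_def atLeast0LessThan)
  finally show ?thesis .
qed

lemma mat_trace_similar:
  fixes A B :: "'a :: comm_ring_1 mat"
  assumes "similar_mat_wit A B P Q"
  shows "mat_trace A = mat_trace B"
proof -
  define n where "n = dim_row A"
  note wit = similar_mat_witD[OF n_def assms]
  have "mat_trace A = mat_trace (P * B * Q)"
    using wit(3) by (rule arg_cong)
  also have "\<dots> = mat_trace (Q * (P * B))"
    by (rule mat_trace_mult_commute[OF mult_carrier_mat[OF wit(6,5)] wit(7)])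
  also have "Q * (P * B) = Q * P * B"
    by (rule assoc_mult_mat[OF wit(7,6,5), symmetric])
  also have "\<dots> = B" unfolding wit(2) using wit(5) by (rule left_mult_one_mat)
  finally show ?thesis .
qed

section \<open>Upper triangular matrices, triangularization and idempotents\<close>

lemma upper_triangular_mult:
  fixes A B :: "'a :: semiring_0 mat"
  assumes "A \<in> carrier_mat n n" "B \<in> carrier_mat n n"
    and "upper_triangular A" "upper_triangular B"
  shows "upper_triangular (A * B)"
    and "i < n \<Longrightarrow> (A * B) $$ (i, i) = A $$ (i, i) * B $$ (i, i)"
proof -
  \<comment> \<open>For \<open>j \<le> i\<close> a term can survive only when
    \<open>l = i = j\<close>: if \<open>l < i\<close> the first factor lies below the diagonal, and
    otherwise \<open>j < l\<close>, so the second one does.\<close>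
  have z: "A $$ (i, l) * B $$ (l, j) = 0" if "i < n" "l < n" "l \<noteq> i \<or> l \<noteq> j" "j \<le> i" for i j l
    using upper_triangularD[OF assms(3), of l i] upper_triangularD[OF assms(4), of j l] that assms(1,2)
    by (cases "l < i") auto
  show "upper_triangular (A * B)"
  proof
    fix i j assume "j < i" "i < dim_row (A * B)"
    then show "(A * B) $$ (i, j) = 0"
      using assms(1,2) by (auto simp: scalar_prod_def intro!: sum.neutral z)
  qed
  assume i: "i < n"
  have "(A * B) $$ (i, i) = (\<Sum>l<n. A $$ (i, l) * B $$ (l, i))"
    using i assms(1,2) by (auto simp: scalar_prod_def atLeast0LessThan)
  also have "\<dots> = (\<Sum>l\<in>{i}. A $$ (i, l) * B $$ (l, i))"
    using i by (intro sum.mono_neutral_right) (auto intro: z)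
  finally show "(A * B) $$ (i, i) = A $$ (i, i) * B $$ (i, i)" by simp
qed

lemma upper_triangular_pow:
  fixes A :: "'a :: semiring_1 mat"
  assumes "A \<in> carrier_mat n n" "upper_triangular A"
  shows "upper_triangular (A ^\<^sub>m k)"
    and "i < n \<Longrightarrow> (A ^\<^sub>m k) $$ (i, i) = A $$ (i, i) ^ k"
proof -
  have "upper_triangular (A ^\<^sub>m k) \<and> (\<forall>i<n. (A ^\<^sub>m k) $$ (i, i) = A $$ (i, i) ^ k)"
  proof (induction k)
    case (Suc k)
    then show ?case
      using upper_triangular_mult[OF pow_carrier_mat[OF assms(1)] assms(1) _ assms(2)]
      by (simp add: power_commutes)
  qed (use assms in auto)
  then show "upper_triangular (A ^\<^sub>m k)"
    and "i < n \<Longrightarrow> (A ^\<^sub>m k) $$ (i, i) = A $$ (i, i) ^ k" by auto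
qed

text \<open>Over the complex numbers the characteristic polynomial splits into linear factors, which
  is what Schur decomposition asks for.\<close>

lemma triangularizable:
  fixes A :: "complex mat"
  assumes "A \<in> carrier_mat n n"
  obtains B P Q where "similar_mat_wit A B P Q" "upper_triangular B"
proof -
  obtain as where "char_poly A = (\<Prod>a\<leftarrow>as. [:- a, 1:])"
    using char_poly_factorized[OF assms] by blast
  from schur_decomposition_exists[OF assms this]
  obtain B where "similar_mat A B" and ut: "upper_triangular B" by auto
  then obtain P Q where "similar_mat_wit A B P Q" unfolding similar_mat_def by auto
  then show thesis using ut by (rule that)
qed

text \<open>A triangular form \<open>B\<close> of \<open>A\<close> is idempotent too, so its
  diagonal entries are 0 or 1 and the trace counts the ones. If there are none, \<open>B\<close> is
  strictly upper triangular and equal to its own square, which forces \<open>B\<close>, and with it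
  \<open>A\<close>, to vanish.\<close>

lemma idempotent_mat_trace:
  fixes A :: "complex mat"
  assumes A: "A \<in> carrier_mat n n" and idem: "A * A = A"
  obtains k :: nat where "mat_trace A = of_nat k" "k = 0 \<Longrightarrow> A = 0\<^sub>m n n"
proof -
  obtain B P Q where sim: "similar_mat_wit A B P Q" and ut: "upper_triangular B"
    using triangularizable[OF A] .
  note wit = similar_mat_witD2[OF A sim]
  have B: "B = Q * A * P"
    using similar_mat_witD2(3)[OF wit(5) similar_mat_wit_sym[OF sim]] .
  have "B * B = Q * A * (P * Q) * (A * P)"
    unfolding B using A wit(6,7) by (simp add: assoc_mult_mat[of _ n n _ n _ n])
  also have "\<dots> = Q * (A * A) * P"
    using A wit(1,6,7) by (simp add: assoc_mult_mat[of _ n n _ n _ n])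
  finally have BB: "B * B = B" unfolding idem B .
  have d: "B $$ (i, i) = 0 \<or> B $$ (i, i) = 1" if "i < n" for i
  proof -
    have "B $$ (i, i) * B $$ (i, i) = B $$ (i, i)"
      using upper_triangular_mult(2)[OF wit(5,5) ut ut that, symmetric] unfolding BB .
    then have "B $$ (i, i) * (B $$ (i, i) - 1) = 0"
      by (simp only: right_diff_distrib mult_1_right diff_self)
    then show ?thesis by simp
  qed
  let ?k = "card {i. i < n \<and> B $$ (i, i) = 1}"
  show ?thesis
  proof (rule that[of ?k])
    have "mat_trace A = (\<Sum>i<n. B $$ (i, i))"
      using mat_trace_similar[OF sim] wit(5) by (simp add: mat_trace_def)
    also have "\<dots> = (\<Sum>i | i < n \<and> B $$ (i, i) = 1. B $$ (i, i))"
      using d by (intro sum.mono_neutral_right) auto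
    finally show "mat_trace A = of_nat ?k" by simp
    assume "?k = 0"
    then have "{i. i < n \<and> B $$ (i, i) = 1} = {}" by simp
    then have z: "B $$ (i, i) = 0" if "i < n" for i using d[OF that] that by blast
    have "B $$ (i, j) = 0" if "i < n" "j < n" for i j
      using that
    \<comment> \<open>The induction runs over the distance above the diagonal. Subtraction is
      truncated, so all positions on or below the diagonal have distance 0; they are settled
      directly, without the induction hypothesis.\<close>
    proof (induction "j - i" arbitrary: i j rule: less_induct)
      case less
      show ?case
      proof (cases "i < j")
        case True
        \<comment> \<open>Expand \<open>B = B * B\<close> at \<open>(i, j)\<close>. In each term one
          factor lies on or below the diagonal, except for \<open>i < l < j\<close>, where
          \<open>(i, l)\<close> is closer to the diagonal than \<open>(i, j)\<close>.\<close>
        have "B $$ (i, l) * B $$ (l, j) = 0" if "l < n" for l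
        proof -
          consider "l < i" | "l = i" | "j \<le> l" "i < l" | "i < l" "l - i < j - i"
            using True by linarith
          then show ?thesis
          proof cases
            case 1
            then show ?thesis using upper_triangularD[OF ut 1] less.prems wit(5) by simp
          next
            case 2
            then show ?thesis using z less.prems by simp
          next
            case 3
            then have "B $$ (l, j) = 0"
              using z upper_triangularD[OF ut, of j l] that wit(5) by (cases "l = j") simp_all
            then show ?thesis by simp
          next
            case 4
            then show ?thesis using less.hyps[OF 4(2) less.prems(1) that] by simp
          qed
        qed
        then have "(B * B) $$ (i, j) = 0"
          using less.prems wit(5) by (auto simp: scalar_prod_def intro!: sum.neutral)
        then show ?thesis by (simp add: BB)
      next
        case False
        then show ?thesis
          using z upper_triangularD[OF ut, of j i] less.prems wit(5) by (cases "i = j") auto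
      qed
    qed
    then have "B = 0\<^sub>m n n" using wit(5) by (intro eq_matI) auto
    then show "A = 0\<^sub>m n n" using wit(3,6,7) by simp
  qed
qed

section \<open>Power sums determine a multiset, and traces of powers the determinant\<close>

lemma sum_mset_single_support:
  fixes h :: "'a \<Rightarrow> 'b :: comm_semiring_1"
  assumes "\<And>x. x \<in># X \<Longrightarrow> x \<noteq> c \<Longrightarrow> h x = 0"
  shows "(\<Sum>x\<in>#X. h x) = of_nat (count X c) * h c"
  using assms
proof (induction X)
  case (add x X)
  from add.prems have "(\<Sum>x\<in>#X. h x) = of_nat (count X c) * h c"
    by (intro add.IH) simp
  moreover have "h x = (if x = c then h c else 0)"
    using add.prems by simp
  ultimately show ?case by (simp add: distrib_right)
qed simp

text \<open>Linear combinations of power sums give the sums of all polynomial values. A polynomial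
  that vanishes at every other element but not at \<open>c\<close> isolates the multiplicity of
  \<open>c\<close>, which can be read off because the characteristic is 0.\<close>

lemma mset_eq_of_power_sums_eq:
  fixes X Y :: "'a :: field_char_0 multiset"
  assumes "\<And>k. (\<Sum>x\<in>#X. x ^ k) = (\<Sum>y\<in>#Y. y ^ k)"
  shows "X = Y"
proof (rule multiset_eqI)
  fix c
  \<comment> \<open>The extra factor \<open>x ^ k\<close> is what makes the induction on
    coefficients work: \<open>pCons\<close> multiplies the remaining polynomial by \<open>x\<close>,
    which raises the exponent by one.\<close>
  have "(\<Sum>x\<in>#X. x ^ k * poly p x) = (\<Sum>y\<in>#Y. y ^ k * poly p y)" for k and p :: "'a poly"
  proof (induction p arbitrary: k)
    case (pCons a p)
    have "(\<Sum>x\<in>#Z. x ^ k * poly (pCons a p) x) = a * (\<Sum>x\<in>#Z. x ^ k) + (\<Sum>x\<in>#Z. x ^ Suc k * poly p x)"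
      for Z :: "'a multiset"
      by (induction Z) (simp_all add: algebra_simps)
    then show ?case by (simp only: assms pCons)
  qed simp
  from this[of 0] have poly_sums: "(\<Sum>x\<in>#X. poly p x) = (\<Sum>y\<in>#Y. poly p y)" for p by simp
  define p where "p = (\<Prod>a\<in>set_mset (X + Y) - {c}. [:- a, 1:])"
  have "poly p c \<noteq> 0" by (auto simp: p_def poly_prod)
  moreover have "poly p x = 0" if "x \<in># X + Y" "x \<noteq> c" for x
    using that by (auto simp: p_def poly_prod)
  then have "of_nat (count X c) * poly p c = of_nat (count Y c) * poly p c"
    using poly_sums[of p] sum_mset_single_support[of X c "poly p"]
      sum_mset_single_support[of Y c "poly p"] by simp
  ultimately show "count X c = count Y c" by simp
qed

text \<open>Triangularization turns the determinant into the product, and the traces of powers into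
  the power sums, of one multiset: the diagonal of the triangular form. Equal power sums give equal
  multisets.\<close>

lemma det_eq_of_trace_pow_eq:
  fixes A B :: "complex mat"
  assumes A: "A \<in> carrier_mat n n" and B: "B \<in> carrier_mat n n"
    and tr: "\<And>k. mat_trace (A ^\<^sub>m k) = mat_trace (B ^\<^sub>m k)"
  shows "det A = det B"
proof -
  have *: "\<exists>X. det C = prod_mset X \<and> (\<forall>k. mat_trace (C ^\<^sub>m k) = (\<Sum>x\<in>#X. x ^ k))"
    if C: "C \<in> carrier_mat n n" for C :: "complex mat"
  proof -
    obtain D P Q where sim: "similar_mat_wit C D P Q" and ut: "upper_triangular D"
      using triangularizable[OF C] .
    note D = similar_mat_witD2(5)[OF C sim]
    let ?X = "image_mset (\<lambda>i. D $$ (i, i)) (mset_set {..<n})"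
    have "det C = det D"
      using sim by (intro det_similar) (auto simp: similar_mat_def)
    also have "\<dots> = (\<Prod>i<n. D $$ (i, i))"
      using det_upper_triangular[OF ut D] D
      by (simp add: prod_list_diag_prod atLeast0LessThan)
    finally have "det C = prod_mset ?X" by (simp add: prod_unfold_prod_mset)
    moreover have "mat_trace (C ^\<^sub>m k) = (\<Sum>x\<in>#?X. x ^ k)" for k
    proof -
      have "mat_trace (C ^\<^sub>m k) = mat_trace (D ^\<^sub>m k)"
        by (rule mat_trace_similar[OF similar_mat_wit_pow[OF sim]])
      also have "\<dots> = (\<Sum>i<n. D $$ (i, i) ^ k)"
        using D upper_triangular_pow(2)[OF D ut]
        by (simp add: mat_trace_def)
      also have "\<dots> = (\<Sum>x\<in>#?X. x ^ k)"
        unfolding sum_unfold_sum_mset image_mset.compositionality o_def ..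
      finally show ?thesis .
    qed
    ultimately show ?thesis by blast
  qed
  obtain X where X: "det A = prod_mset X" "\<And>k. mat_trace (A ^\<^sub>m k) = (\<Sum>x\<in>#X. x ^ k)"
    using *[OF A] by auto
  obtain Y where Y: "det B = prod_mset Y" "\<And>k. mat_trace (B ^\<^sub>m k) = (\<Sum>x\<in>#Y. x ^ k)"
    using *[OF B] by auto
  have "X = Y"
    by (rule mset_eq_of_power_sums_eq) (simp only: X(2)[symmetric] Y(2)[symmetric] tr)
  then show ?thesis using X(1) Y(1) by simp
qed

section \<open>Block matrices, given by a labelling of the indices, and their trace\<close>

definition block_mats :: "nat \<Rightarrow> (nat \<Rightarrow> nat) \<Rightarrow> complex mat set" where
  "block_mats N b =
    {A \<in> carrier_mat N N. \<forall>i<N. \<forall>j<N. b i \<noteq> b j \<longrightarrow> A $$ (i, j) = 0}"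

definition mat_unit :: "nat \<Rightarrow> nat \<times> nat \<Rightarrow> complex mat" where
  "mat_unit N p = mat N N (\<lambda>q. if q = p then 1 else 0)"

lemma mat_unit_in_block_mats: "b i = b j \<Longrightarrow> mat_unit N (i, j) \<in> block_mats N b"
  by (auto simp: block_mats_def mat_unit_def)

lemma mat_unit_mult:
  assumes "j < N" "k < N"
  shows "mat_unit N (i, j) * mat_unit N (k, l) = (if j = k then mat_unit N (i, l) else 0\<^sub>m N N)"
proof (rule eq_matI, goal_cases)
  case (1 r s)
  then have rs: "r < N" "s < N" by (auto simp: mat_unit_def split: if_splits)
  then have "(mat_unit N (i, j) * mat_unit N (k, l)) $$ (r, s) =
      (\<Sum>t<N. (if r = i \<and> t = j then 1 else 0) * (if t = k \<and> s = l then 1 else 0))"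
    by (simp add: mat_unit_def scalar_prod_def atLeast0LessThan)
  also have "\<dots> = (\<Sum>t<N. if t = j then (if r = i \<and> j = k \<and> s = l then 1 else 0) else 0)"
    by (intro sum.cong) auto
  also have "\<dots> = (if r = i \<and> j = k \<and> s = l then 1 else 0)"
    using assms by simp
  finally show ?case using rs by (simp add: mat_unit_def)
qed (auto simp: mat_unit_def)

text \<open>Since \<open>f\<close> is linear only on \<open>block_mats N b\<close>, the matrix is
  built up one admissible position at a time, and every partial matrix \<open>R S\<close> stays in
  that set.\<close>

lemma block_mats_expansion:
  fixes f :: "complex mat \<Rightarrow> complex"
  assumes add: "\<And>A B. A \<in> block_mats N b \<Longrightarrow> B \<in> block_mats N b \<Longrightarrow> f (A + B) = f A + f B"
    and smult: "\<And>c A. A \<in> block_mats N b \<Longrightarrow> f (c \<cdot>\<^sub>m A) = c * f A"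
    and A: "A \<in> block_mats N b"
  shows "f A = (\<Sum>p | fst p < N \<and> snd p < N \<and> b (fst p) = b (snd p). A $$ p * f (mat_unit N p))"
proof -
  let ?D = "{p. fst p < N \<and> snd p < N \<and> b (fst p) = b (snd p)}"
  define R where "R S = mat N N (\<lambda>p. if p \<in> S then A $$ p else 0)" for S
  have R: "R S \<in> block_mats N b" if "S \<subseteq> ?D" for S
    using that by (auto simp: R_def block_mats_def)
  have "?D \<subseteq> {..<N} \<times> {..<N}" by auto
  then have "finite ?D" by (rule finite_subset) simp
  then have "f (R ?D) = (\<Sum>p\<in>?D. A $$ p * f (mat_unit N p))"
  using subset_refl
  proof (induction rule: finite_subset_induct')
    case empty
    \<comment> \<open>The value of \<open>f\<close> at the zero matrix comes from homogeneity, by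
      scaling that matrix by 0.\<close>
    have "R {} = 0 \<cdot>\<^sub>m R {}" by (auto simp: R_def)
    then have "f (R {}) = 0 * f (R {})" using smult[OF R[of "{}"], of 0] by simp
    then show ?case by simp
  next
    case (insert p S)
    have unit: "mat_unit N p \<in> block_mats N b"
      using insert.hyps(2) mat_unit_in_block_mats[of b "fst p" "snd p"] by simp
    then have unit': "A $$ p \<cdot>\<^sub>m mat_unit N p \<in> block_mats N b"
      by (auto simp: block_mats_def mat_unit_def)
    have "R (insert p S) = R S + A $$ p \<cdot>\<^sub>m mat_unit N p"
      using insert.hyps(4) by (auto simp: R_def mat_unit_def intro!: eq_matI)
    then have "f (R (insert p S)) = f (R S) + A $$ p * f (mat_unit N p)"
      using add[OF R[OF insert.hyps(3)] unit'] smult[OF unit] by simp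
    then show ?case using insert by simp
  qed
  moreover have "R ?D = A"
    using A by (auto simp: R_def block_mats_def intro!: eq_matI)
  ultimately show ?thesis by simp
qed

text \<open>Linearity and symmetry under \<open>A * B\<close> and \<open>B * A\<close> alone would
  still allow a different scalar weight on each block. The condition on idempotents makes the
  weights positive integers, and the value at the identity then leaves only 1. The lemma is meant
  for the trace of the image under an algebra isomorphism.\<close>

lemma block_mats_trace_unique:
  fixes f :: "complex mat \<Rightarrow> complex"
  assumes add: "\<And>A B. A \<in> block_mats N b \<Longrightarrow> B \<in> block_mats N b \<Longrightarrow> f (A + B) = f A + f B"
    and smult: "\<And>c A. A \<in> block_mats N b \<Longrightarrow> f (c \<cdot>\<^sub>m A) = c * f A"
    and comm: "\<And>A B. A \<in> block_mats N b \<Longrightarrow> B \<in> block_mats N b \<Longrightarrow> f (A * B) = f (B * A)"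
    and one: "f (1\<^sub>m N) = of_nat N"
    and idem: "\<And>A. A \<in> block_mats N b \<Longrightarrow> A * A = A \<Longrightarrow>
      \<exists>k::nat. f A = of_nat k \<and> (k = 0 \<longrightarrow> A = 0\<^sub>m N N)"
    and A: "A \<in> block_mats N b"
  shows "f A = mat_trace A"
proof -
  let ?D = "{p. fst p < N \<and> snd p < N \<and> b (fst p) = b (snd p)}"
  have "?D \<subseteq> {..<N} \<times> {..<N}" by auto
  then have finD: "finite ?D" by (rule finite_subset) simp
  have one_mem: "1\<^sub>m N \<in> block_mats N b" by (auto simp: block_mats_def)
  moreover have "(0 :: complex) \<cdot>\<^sub>m 1\<^sub>m N = 0\<^sub>m N N" by auto
  ultimately have "f (0\<^sub>m N N) = 0" using smult[of "1\<^sub>m N" 0] by simp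
  \<comment> \<open>For \<open>i \<noteq> j\<close>, E_ii E_ij = E_ij while E_ij E_ii = 0, so
    symmetry of \<open>f\<close> yields the value 0.\<close>
  then have off: "f (mat_unit N (i, j)) = 0" if "i < N" "j < N" "b i = b j" "i \<noteq> j" for i j
    using comm[of "mat_unit N (i, i)" "mat_unit N (i, j)"] that
    by (simp add: mat_unit_mult mat_unit_in_block_mats)
  have diag: "f C = (\<Sum>i<N. C $$ (i, i) * f (mat_unit N (i, i)))" if C: "C \<in> block_mats N b" for C
  proof -
    have "f C = (\<Sum>p\<in>?D. C $$ p * f (mat_unit N p))"
      using add smult C by (rule block_mats_expansion)
    also have "\<dots> = (\<Sum>p\<in>(\<lambda>i. (i, i)) ` {..<N}. C $$ p * f (mat_unit N p))"
      using off by (intro sum.mono_neutral_right finD) (auto simp: image_iff)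
    also have "\<dots> = (\<Sum>i<N. C $$ (i, i) * f (mat_unit N (i, i)))"
      by (subst sum.reindex) (auto simp: inj_on_def)
    finally show ?thesis .
  qed
  have "\<exists>k::nat. f (mat_unit N (i, i)) = of_nat k \<and> 1 \<le> k" if "i < N" for i
  proof -
    have "mat_unit N (i, i) $$ (i, i) \<noteq> 0\<^sub>m N N $$ (i, i)"
      using that by (simp add: mat_unit_def)
    then have "mat_unit N (i, i) \<noteq> 0\<^sub>m N N" by auto
    moreover have "mat_unit N (i, i) * mat_unit N (i, i) = mat_unit N (i, i)"
      using that by (simp add: mat_unit_mult)
    from idem[OF mat_unit_in_block_mats[OF refl] this]
    obtain k :: nat where "f (mat_unit N (i, i)) = of_nat k"
      and "k = 0 \<longrightarrow> mat_unit N (i, i) = 0\<^sub>m N N" by blast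
    ultimately show ?thesis by (intro exI[of _ k]) auto
  qed
  then obtain k :: "nat \<Rightarrow> nat"
    where k: "\<And>i. i < N \<Longrightarrow> f (mat_unit N (i, i)) = of_nat (k i) \<and> 1 \<le> k i"
    by metis
  have "of_nat N = f (1\<^sub>m N)" by (simp add: one)
  also have "\<dots> = (\<Sum>i<N. of_nat (k i))"
    using k by (simp add: diag[OF one_mem])
  finally have "(\<Sum>i<N. k i) = N"
    by (metis of_nat_eq_iff of_nat_sum)
  \<comment> \<open>There are \<open>N\<close> integers \<open>k i\<close>, each at least 1, with
    sum \<open>N\<close>, so their total excess over 1 is 0. Truncated subtraction is exact here
    because \<open>1 \<le> k i\<close>.\<close>
  moreover have "(\<Sum>i<N. k i) = (\<Sum>i<N. k i - 1) + (\<Sum>i<N. 1)"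
    unfolding sum.distrib[symmetric]
  proof (rule sum.cong)
    fix i assume "i \<in> {..<N}"
    then have "1 \<le> k i" using k by blast
    then show "k i = k i - 1 + 1" by simp
  qed simp
  ultimately have "(\<Sum>i<N. k i - 1) = 0" by simp
  then have "k i = 1" if "i < N" for i
    using k[OF that] that by (simp add: le_antisym)
  then have "f A = (\<Sum>i<N. A $$ (i, i))"
    using k by (subst diag[OF A]) simp
  then show ?thesis using A by (auto simp: mat_trace_def block_mats_def)
qed

section \<open>The target algebras as algebras of block matrices\<close>

lemma diag_block_mat_carrier:
  assumes "set Bs \<subseteq> carrier_mat n n"
  shows "diag_block_mat Bs \<in> carrier_mat (length Bs * n) (length Bs * n)"
  using assms by (induction Bs) (auto simp: Let_def)

text \<open>With equal block sizes the quotient of an index by \<open>n\<close> names its block and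
  the remainder its place there. Peeling off the first block shifts indices by \<open>n\<close>,
  lowering the quotient by one and keeping the remainder.\<close>

lemma diag_block_mat_index:
  assumes "set Bs \<subseteq> carrier_mat n n" "i < length Bs * n" "j < length Bs * n"
  shows "diag_block_mat Bs $$ (i, j) =
    (if i div n = j div n then (Bs ! (i div n)) $$ (i mod n, j mod n) else 0)"
  using assms
proof (induction Bs arbitrary: i j)
  case (Cons B Bs)
  then have n: "n > 0" by (cases n) auto
  have B: "B \<in> carrier_mat n n" using Cons.prems by simp
  have D: "diag_block_mat Bs \<in> carrier_mat (length Bs * n) (length Bs * n)"
    using Cons.prems by (intro diag_block_mat_carrier) auto
  have dm: "l div n = Suc ((l - n) div n)" "l mod n = (l - n) mod n" if "\<not> l < n" for l
    using that n by (simp_all add: le_div_geq le_mod_geq)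
  have *: "diag_block_mat (B # Bs) $$ (i, j) =
      (if i < n then if j < n then B $$ (i, j) else 0
       else if j < n then 0 else diag_block_mat Bs $$ (i - n, j - n))"
    using B D Cons.prems(2,3) by (auto simp: Let_def)
  have "diag_block_mat Bs $$ (i - n, j - n) =
      (if (i - n) div n = (j - n) div n
       then (Bs ! ((i - n) div n)) $$ ((i - n) mod n, (j - n) mod n) else 0)"
    if "\<not> i < n" "\<not> j < n"
    using Cons.prems that by (intro Cons.IH) auto
  with * show ?case
    using dm by (cases "i < n"; cases "j < n") simp_all
qed simp

lemma block_algebra_carrier:
  assumes "n > 0"
  shows "carrier (block_algebra k n) = block_mats (k * n) (\<lambda>i. i div n)"
proof (intro equalityI subsetI)
  fix A assume "A \<in> carrier (block_algebra k n)"
  then obtain Bs where Bs: "A = diag_block_mat Bs" "length Bs = k" "set Bs \<subseteq> carrier_mat n n"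
    by (auto simp: block_algebra_def)
  have "A \<in> carrier_mat (k * n) (k * n)"
    using Bs diag_block_mat_carrier[of Bs n] by simp
  then show "A \<in> block_mats (k * n) (\<lambda>i. i div n)"
    using Bs by (auto simp: block_mats_def diag_block_mat_index)
next
  fix A assume A: "A \<in> block_mats (k * n) (\<lambda>i. i div n)"
  \<comment> \<open>The diagonal blocks are cut out of \<open>A\<close>; entries outside them vanish
    by membership in \<open>block_mats\<close>.\<close>
  define Bs where "Bs = map (\<lambda>q. mat n n (\<lambda>(r, s). A $$ (q * n + r, q * n + s))) [0..<k]"
  have Bs: "length Bs = k" "set Bs \<subseteq> carrier_mat n n" by (auto simp: Bs_def)
  have dim: "diag_block_mat Bs \<in> carrier_mat (k * n) (k * n)"
    using Bs diag_block_mat_carrier[of Bs n] by simp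
  have "A = diag_block_mat Bs"
  proof (rule eq_matI)
    fix i j assume "i < dim_row (diag_block_mat Bs)" "j < dim_col (diag_block_mat Bs)"
    then have ij: "i < k * n" "j < k * n" using dim by auto
    then have q: "i div n < k" "j div n < k" by (simp_all add: less_mult_imp_div_less)
    have "j div n * n + i mod n = i" if "i div n = j div n"
      using div_mult_mod_eq[of i n] that by simp
    moreover have "A $$ (i, j) = 0" if "i div n \<noteq> j div n"
      using A ij that by (simp add: block_mats_def)
    ultimately show "A $$ (i, j) = diag_block_mat Bs $$ (i, j)"
      using Bs ij q assms by (subst diag_block_mat_index) (auto simp: Bs_def)
  qed (use A dim in \<open>auto simp: block_mats_def\<close>)
  then show "A \<in> carrier (block_algebra k n)"
    using Bs by (auto simp: block_algebra_def)
qed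

text \<open>This removes the case distinction on the parity of \<open>d\<close>: a constant
  labelling gives the full matrix algebra, and division by the block size gives the direct sum.
  Positivity of \<open>m\<close> keeps that block size positive.\<close>

lemma target_algebra_block_mats:
  assumes "m > 0"
  obtains N b where "carrier (target_algebra m d) = block_mats N b"
    "monoid.mult (target_algebra m d) = (*)" "ring.add (target_algebra m d) = (+)"
    "monoid.one (target_algebra m d) = 1\<^sub>m N" "module.smult (target_algebra m d) = (\<cdot>\<^sub>m)"
proof (cases "even d")
  case True
  let ?N = "m ^ (d div 2)"
  have "carrier (target_algebra m d) = block_mats ?N (\<lambda>_. 0)"
    using True by (simp add: target_algebra_def module_mat_simps block_mats_def)
  from that[OF this] show thesis
    using True by (simp add: target_algebra_def module_mat_simps)
next
  case False
  let ?n = "m ^ ((d - 1) div 2)"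
  have "carrier (target_algebra m d) = block_mats (m * ?n) (\<lambda>i. i div ?n)"
    using False assms by (simp add: target_algebra_def block_algebra_carrier)
  from that[OF this] show thesis
    using False by (simp add: target_algebra_def block_algebra_def module_mat_simps)
qed

section \<open>Closure of the generalized Clifford algebra under its operations\<close>

lemma quotient_algebra_simps:
  "carrier (quotient_algebra A I) = carrier (A Quot I)"
  "monoid.mult (quotient_algebra A I) = monoid.mult (A Quot I)"
  "ring.add (quotient_algebra A I) = ring.add (A Quot I)"
  "monoid.one (quotient_algebra A I) = monoid.one (A Quot I)"
  by (simp_all add: quotient_algebra_def ring.defs)

lemma quotient_algebra_closed:
  assumes "ideal I A" "X \<in> carrier (quotient_algebra A I)" "Y \<in> carrier (quotient_algebra A I)"
  shows "X \<otimes>\<^bsub>quotient_algebra A I\<^esub> Y \<in> carrier (quotient_algebra A I)"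
    and "X \<oplus>\<^bsub>quotient_algebra A I\<^esub> Y \<in> carrier (quotient_algebra A I)"
    and "\<one>\<^bsub>quotient_algebra A I\<^esub> \<in> carrier (quotient_algebra A I)"
proof -
  interpret Q: ring "A Quot I" using assms(1) by (rule ideal.quotient_is_ring)
  show "X \<otimes>\<^bsub>quotient_algebra A I\<^esub> Y \<in> carrier (quotient_algebra A I)"
    and "X \<oplus>\<^bsub>quotient_algebra A I\<^esub> Y \<in> carrier (quotient_algebra A I)"
    and "\<one>\<^bsub>quotient_algebra A I\<^esub> \<in> carrier (quotient_algebra A I)"
    using assms(2,3) by (simp_all add: quotient_algebra_simps)
qed

text \<open>The scalar action on the quotient is a union of cosets over all representatives. It is a
  single coset because \<open>c\<close> acts as left multiplication by a ring element
  \<open>u\<close>, which maps the ideal into itself.\<close>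

lemma quotient_algebra_smult_closed:
  fixes A :: "(complex, 'a) module"
  assumes "ideal I A" and u: "u \<in> carrier A"
    and smult: "\<And>x. x \<in> carrier A \<Longrightarrow> c \<odot>\<^bsub>A\<^esub> x = u \<otimes>\<^bsub>A\<^esub> x"
    and X: "X \<in> carrier (quotient_algebra A I)"
  shows "c \<odot>\<^bsub>quotient_algebra A I\<^esub> X \<in> carrier (quotient_algebra A I)"
proof -
  interpret ideal I A by fact
  obtain a where a: "a \<in> carrier A" "X = I +>\<^bsub>A\<^esub> a"
    using X by (auto simp: quotient_algebra_simps FactRing_simps)
  have "I +>\<^bsub>A\<^esub> (c \<odot>\<^bsub>A\<^esub> x) = I +>\<^bsub>A\<^esub> (u \<otimes>\<^bsub>A\<^esub> a)" if x: "x \<in> X" for x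
  proof -
    obtain i where i: "i \<in> I" "x = i \<oplus>\<^bsub>A\<^esub> a"
      using x a by (auto simp: a_r_coset_def r_coset_def)
    then have iA: "i \<in> carrier A" by auto
    then have xA: "x \<in> carrier A" using i a by simp
    have "c \<odot>\<^bsub>A\<^esub> x = u \<otimes>\<^bsub>A\<^esub> i \<oplus>\<^bsub>A\<^esub> u \<otimes>\<^bsub>A\<^esub> a"
      using smult[OF xA] i iA u a by (simp add: r_distr)
    moreover have "u \<otimes>\<^bsub>A\<^esub> i \<in> I" using i u by (simp add: I_l_closed)
    ultimately have "c \<odot>\<^bsub>A\<^esub> x \<in> I +>\<^bsub>A\<^esub> (u \<otimes>\<^bsub>A\<^esub> a)"
      by (auto simp: a_r_coset_def r_coset_def)
    then show ?thesis
      using a_repr_independence[OF _ _ a_subgroup] u a by (metis m_closed)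
  qed
  moreover have "a \<in> X" using a by (simp add: a_rcos_self)
  ultimately have "(\<Union>x\<in>X. I +>\<^bsub>A\<^esub> (c \<odot>\<^bsub>A\<^esub> x)) = I +>\<^bsub>A\<^esub> (u \<otimes>\<^bsub>A\<^esub> a)" by auto
  then have "c \<odot>\<^bsub>quotient_algebra A I\<^esub> X = I +>\<^bsub>A\<^esub> (u \<otimes>\<^bsub>A\<^esub> a)"
    by (simp add: quotient_algebra_def ring.defs module.defs)
  then show ?thesis
    using u a by (auto simp: quotient_algebra_simps FactRing_simps)
qed

text \<open>The multiple of the unit by \<open>c\<close> is the element \<open>u\<close> through
  which scalars act on the quotient.\<close>

lemma free_algebra_smult:
  assumes "f \<in> carrier (free_algebra d)"
  shows "c \<odot>\<^bsub>free_algebra d\<^esub> \<one>\<^bsub>free_algebra d\<^esub> \<in> carrier (free_algebra d)"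
    and "c \<odot>\<^bsub>free_algebra d\<^esub> f = (c \<odot>\<^bsub>free_algebra d\<^esub> \<one>\<^bsub>free_algebra d\<^esub>) \<otimes>\<^bsub>free_algebra d\<^esub> f"
    and "c \<odot>\<^bsub>free_algebra d\<^esub> f \<in> carrier (free_algebra d)"
proof -
  show u: "c \<odot>\<^bsub>free_algebra d\<^esub> \<one>\<^bsub>free_algebra d\<^esub> \<in> carrier (free_algebra d)"
    by (auto simp: free_algebra_def)
  have "(\<Sum>(u, v)\<in>{(u, v). u @ v = w}. c * (if u = [] then 1 else 0) * f v) = c * f w" for w
    using sum_factorizations_unit_left[of f w]
    by (simp add: sum_distrib_left[symmetric] case_prod_beta mult.assoc)
  then show eq: "c \<odot>\<^bsub>free_algebra d\<^esub> f =
      (c \<odot>\<^bsub>free_algebra d\<^esub> \<one>\<^bsub>free_algebra d\<^esub>) \<otimes>\<^bsub>free_algebra d\<^esub> f"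
    by (simp add: free_algebra_def)
  show "c \<odot>\<^bsub>free_algebra d\<^esub> f \<in> carrier (free_algebra d)"
    unfolding eq using u assms by (rule free_algebra_mult_closed)
qed

lemma clifford_relators_carrier: "clifford_relators m d \<subseteq> carrier (free_algebra d)"
proof -
  interpret F: ring "free_algebra d" by (rule free_algebra_ring)
  have letter: "letter j \<in> carrier (free_algebra d)" if "1 \<le> j" "j \<le> d" for j
    using that by (auto simp: free_algebra_def letter_def)
  show ?thesis
    by (auto simp: clifford_relators_def Let_def
        intro!: F.minus_closed F.nat_pow_closed F.m_closed free_algebra_smult(3) letter)
qed

text \<open>A comparison of two representations through preimages is valid only inside the carrier,
  so sums, products, the unit and scalar multiples must be known to stay there.\<close>

lemma gen_clifford_closed:
  assumes X: "X \<in> carrier (gen_clifford m d)"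
  shows "Y \<in> carrier (gen_clifford m d) \<Longrightarrow>
      X \<otimes>\<^bsub>gen_clifford m d\<^esub> Y \<in> carrier (gen_clifford m d)"
    and "Y \<in> carrier (gen_clifford m d) \<Longrightarrow>
      X \<oplus>\<^bsub>gen_clifford m d\<^esub> Y \<in> carrier (gen_clifford m d)"
    and "\<one>\<^bsub>gen_clifford m d\<^esub> \<in> carrier (gen_clifford m d)"
    and "c \<odot>\<^bsub>gen_clifford m d\<^esub> X \<in> carrier (gen_clifford m d)"
proof -
  have I: "ideal (Idl\<^bsub>free_algebra d\<^esub> (clifford_relators m d)) (free_algebra d)"
    by (rule ring.genideal_ideal[OF free_algebra_ring clifford_relators_carrier])
  have one: "\<one>\<^bsub>free_algebra d\<^esub> \<in> carrier (free_algebra d)"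
    by (rule monoid.one_closed[OF ring.is_monoid[OF free_algebra_ring]])
  note closed = quotient_algebra_closed[OF I, folded gen_clifford_def]
  show "Y \<in> carrier (gen_clifford m d) \<Longrightarrow>
      X \<otimes>\<^bsub>gen_clifford m d\<^esub> Y \<in> carrier (gen_clifford m d)"
    and "Y \<in> carrier (gen_clifford m d) \<Longrightarrow>
      X \<oplus>\<^bsub>gen_clifford m d\<^esub> Y \<in> carrier (gen_clifford m d)"
    and "\<one>\<^bsub>gen_clifford m d\<^esub> \<in> carrier (gen_clifford m d)"
    using closed X by blast+
  show "c \<odot>\<^bsub>gen_clifford m d\<^esub> X \<in> carrier (gen_clifford m d)"
    unfolding gen_clifford_def
    by (rule quotient_algebra_smult_closed[OF I free_algebra_smult(1)[OF one] free_algebra_smult(2)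
          X[unfolded gen_clifford_def]])
qed

section \<open>Comparison of two representations\<close>

theorem lemma7p3:
  fixes m d :: nat
    and \<gamma> \<gamma>' :: "(nat list \<Rightarrow> complex) set \<Rightarrow> complex mat"
    and U :: "(nat list \<Rightarrow> complex) set"
  assumes "m \<ge> 2" and "d \<ge> 1"
    and "faithful_minimal_rep m d \<gamma>"
    and "faithful_minimal_rep m d \<gamma>'"
    and "U \<in> carrier (gen_clifford m d)"
  shows "det (\<gamma> U) = det (\<gamma>' U)"
proof -
  let ?G = "gen_clifford m d" and ?T = "target_algebra m d"
  obtain N b where T: "carrier ?T = block_mats N b" "monoid.mult ?T = (*)" "ring.add ?T = (+)"
    "monoid.one ?T = 1\<^sub>m N" "module.smult ?T = (\<cdot>\<^sub>m)"
    using target_algebra_block_mats[of m d] assms(1) by auto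
  \<comment> \<open>All that is used of a representation, stated once so that it serves both
    \<gamma> and \<gamma>'.\<close>
  have rep: "\<delta> ` carrier ?G = block_mats N b \<and> inj_on \<delta> (carrier ?G) \<and>
      \<delta> \<one>\<^bsub>?G\<^esub> = 1\<^sub>m N \<and>
      (\<forall>X\<in>carrier ?G. \<delta> X \<in> carrier_mat N N \<and> (\<forall>c. \<delta> (c \<odot>\<^bsub>?G\<^esub> X) = c \<cdot>\<^sub>m \<delta> X) \<and>
        (\<forall>Y\<in>carrier ?G. \<delta> (X \<oplus>\<^bsub>?G\<^esub> Y) = \<delta> X + \<delta> Y \<and> \<delta> (X \<otimes>\<^bsub>?G\<^esub> Y) = \<delta> X * \<delta> Y))"
    if "faithful_minimal_rep m d \<delta>" for \<delta>
  proof -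
    have iso: "\<delta> \<in> ring_iso ?G ?T"
      and smult: "\<And>c X. X \<in> carrier ?G \<Longrightarrow> \<delta> (c \<odot>\<^bsub>?G\<^esub> X) = c \<cdot>\<^sub>m \<delta> X"
      using that by (simp_all add: faithful_minimal_rep_def algebra_iso_def T)
    have img: "\<delta> ` carrier ?G = block_mats N b" and inj: "inj_on \<delta> (carrier ?G)"
      using ring_iso_memE(5)[OF iso] by (simp_all add: bij_betw_def T)
    have "\<delta> X \<in> carrier_mat N N" if "X \<in> carrier ?G" for X
    proof -
      have "\<delta> X \<in> block_mats N b" using that img by blast
      then show ?thesis by (simp add: block_mats_def)
    qed
    then show ?thesis
      using img inj smult ring_iso_memE(2-4)[OF iso] by (simp add: T)
  qed
  note g = rep[OF assms(3)] and g' = rep[OF assms(4)]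
  have inj: "inj_on \<gamma> (carrier ?G)" "inj_on \<gamma>' (carrier ?G)"
    using g g' by simp_all
  \<comment> \<open>Only values on the image of \<gamma>, that is on \<open>block_mats N b\<close>,
    are meaningful.\<close>
  define \<phi> where "\<phi> A = \<gamma>' (inv_into (carrier ?G) \<gamma> A)" for A
  have \<phi>: "\<phi> (\<gamma> X) = \<gamma>' X" if "X \<in> carrier ?G" for X
    using that g by (simp add: \<phi>_def)
  have ex: "\<exists>X\<in>carrier ?G. A = \<gamma> X" if "A \<in> block_mats N b" for A
    using that g by blast
  \<comment> \<open>Each condition on the functional is checked by pulling matrices back along
    \<gamma> and computing with their images under \<gamma>'.\<close>
  have trace_\<phi>: "mat_trace (\<phi> A) = mat_trace A" if A: "A \<in> block_mats N b" for A
  proof (rule block_mats_trace_unique[where f = "\<lambda>A. mat_trace (\<phi> A)", OF _ _ _ _ _ A])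
    fix A B assume "A \<in> block_mats N b" "B \<in> block_mats N b"
    then obtain X Y where XY: "X \<in> carrier ?G" "Y \<in> carrier ?G" "A = \<gamma> X" "B = \<gamma> Y"
      using ex by meson
    then have "\<phi> (A + B) = \<gamma>' (X \<oplus>\<^bsub>?G\<^esub> Y)" "\<phi> (A * B) = \<gamma>' (X \<otimes>\<^bsub>?G\<^esub> Y)"
      "\<phi> (B * A) = \<gamma>' (Y \<otimes>\<^bsub>?G\<^esub> X)"
      using g \<phi>[OF gen_clifford_closed(2)[of X m d Y]] \<phi>[OF gen_clifford_closed(1)[of X m d Y]]
        \<phi>[OF gen_clifford_closed(1)[of Y m d X]] by simp_all
    then have "\<phi> (A + B) = \<gamma>' X + \<gamma>' Y" "\<phi> (A * B) = \<gamma>' X * \<gamma>' Y" "\<phi> (B * A) = \<gamma>' Y * \<gamma>' X"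
      using XY g' by simp_all
    moreover have "\<gamma>' X \<in> carrier_mat N N" "\<gamma>' Y \<in> carrier_mat N N" using XY g' by simp_all
    ultimately show "mat_trace (\<phi> (A + B)) = mat_trace (\<phi> A) + mat_trace (\<phi> B)"
      and "mat_trace (\<phi> (A * B)) = mat_trace (\<phi> (B * A))"
      using XY \<phi> by (simp_all add: mat_trace_add mat_trace_mult_commute)
  next
    fix c A assume "A \<in> block_mats N b"
    then obtain X where X: "X \<in> carrier ?G" "A = \<gamma> X" using ex by meson
    then have "\<phi> (c \<cdot>\<^sub>m A) = \<gamma>' (c \<odot>\<^bsub>?G\<^esub> X)"
      using g \<phi>[OF gen_clifford_closed(4)[OF X(1), of c]] by simp
    then show "mat_trace (\<phi> (c \<cdot>\<^sub>m A)) = c * mat_trace (\<phi> A)"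
      using X g' \<phi> mat_trace_smult[of "\<gamma>' X" N c] by simp
  next
    have "\<phi> (1\<^sub>m N) = 1\<^sub>m N"
      using g g' \<phi>[OF gen_clifford_closed(3)[OF assms(5)]] by simp
    then show "mat_trace (\<phi> (1\<^sub>m N)) = of_nat N" by (simp add: mat_trace_def)
  next
    fix A assume "A \<in> block_mats N b" and idem: "A * A = A"
    then obtain X where X: "X \<in> carrier ?G" "A = \<gamma> X" using ex by meson
    have closed: "X \<otimes>\<^bsub>?G\<^esub> X \<in> carrier ?G" "0 \<odot>\<^bsub>?G\<^esub> X \<in> carrier ?G"
      using X(1) by (auto intro: gen_clifford_closed)
    have "\<gamma> (X \<otimes>\<^bsub>?G\<^esub> X) = \<gamma> X" using g X idem by simp
    then have "X \<otimes>\<^bsub>?G\<^esub> X = X"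
      using inj_onD[OF inj(1)] closed(1) X(1) by blast
    then have "\<gamma>' X * \<gamma>' X = \<gamma>' X" using g' X(1) by metis
    moreover have carr: "\<gamma> X \<in> carrier_mat N N" "\<gamma>' X \<in> carrier_mat N N"
      using g g' X(1) by simp_all
    ultimately obtain k :: nat
      where k: "mat_trace (\<gamma>' X) = of_nat k" "k = 0 \<Longrightarrow> \<gamma>' X = 0\<^sub>m N N"
      using idempotent_mat_trace by blast
    have "A = 0\<^sub>m N N" if "k = 0"
    proof -
      \<comment> \<open>The zero of the algebra is written as 0 times \<open>X\<close>, since
        \<open>rep\<close> controls scalar multiples. Injectivity of \<gamma>' identifies it with
        \<open>X\<close>, and applying \<gamma> gives \<open>A = 0\<close>.\<close>
      have "\<gamma>' (0 \<odot>\<^bsub>?G\<^esub> X) = \<gamma>' X" using g' X(1) k(2)[OF that] by simp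
      then have "0 \<odot>\<^bsub>?G\<^esub> X = X"
        using inj_onD[OF inj(2)] closed(2) X(1) by blast
      then have "\<gamma> X = 0 \<cdot>\<^sub>m \<gamma> X" using g X(1) by metis
      also have "\<dots> = 0\<^sub>m N N" using carr(1) by auto
      finally show ?thesis using X(2) by simp
    qed
    then show "\<exists>k::nat. mat_trace (\<phi> A) = of_nat k \<and> (k = 0 \<longrightarrow> A = 0\<^sub>m N N)"
      using k(1) X \<phi> by auto
  qed
  have trace: "mat_trace (\<gamma> X) = mat_trace (\<gamma>' X)" if "X \<in> carrier ?G" for X
  proof -
    have "\<gamma> X \<in> block_mats N b" using that g by blast
    then show ?thesis using trace_\<phi>[of "\<gamma> X"] \<phi>[OF that] by simp
  qed
  \<comment> \<open>A single algebra element, the \<open>k\<close>-th power of \<open>U\<close>, has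
    both matrix powers as its images, so \<open>trace\<close> applies to it.\<close>
  have "\<exists>X\<in>carrier ?G. \<gamma> X = \<gamma> U ^\<^sub>m k \<and> \<gamma>' X = \<gamma>' U ^\<^sub>m k" for k
  proof (induction k)
    case 0
    then show ?case
      using g g' assms(5) gen_clifford_closed(3)[OF assms(5)]
      by (intro bexI[of _ "\<one>\<^bsub>?G\<^esub>"]) auto
  next
    case (Suc k)
    then obtain X where X: "X \<in> carrier ?G" "\<gamma> X = \<gamma> U ^\<^sub>m k" "\<gamma>' X = \<gamma>' U ^\<^sub>m k" by blast
    show ?case
    proof
      show "\<gamma> (X \<otimes>\<^bsub>?G\<^esub> U) = \<gamma> U ^\<^sub>m Suc k \<and> \<gamma>' (X \<otimes>\<^bsub>?G\<^esub> U) = \<gamma>' U ^\<^sub>m Suc k"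
        using X assms(5) g g' by simp
    qed (rule gen_clifford_closed(1)[OF X(1) assms(5)])
  qed
  then have "mat_trace (\<gamma> U ^\<^sub>m k) = mat_trace (\<gamma>' U ^\<^sub>m k)" for k
    using trace by metis
  then show ?thesis
    using g g' assms(5) by (intro det_eq_of_trace_pow_eq[of _ N]) auto
qed

end
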